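(* Let $X$ be a compact metric space with metric $d$, let $T\colon X\to X$ be a homeomorphism, let $\mu$ be a $T$-invariant Borel probability measure on $X$, and let $f\in L^1(X,\mu)$. Then the following statements are equivalent: (1) $f$ is $(\mu,d)$-mean equicontinuous. (2) $f$ is $\mu$-mean equicontinuous.
   Context: Here $f$ is regarded as an everywhere-defined measurable representative of its class. $f\in L^1(X,\mu)$ is $(\mu,d)$-mean equicontinuous if for any $\tau>0$ there is a compact subset $K\subset X$ with $\mu(K)>1-\tau$ such that for any $\epsilon>0$ there is $\delta>0$ such that whenever $x,y\in K$ with $d(x,y)<\delta$ we have $$\limsup_{n\to\infty}\frac1n\sum_{i=0}^{n-1}|f(T^ix)-f(T^iy)|<\epsilon.$$ $f\in L^1(X,\mu)$ is $\mu$-mean equicontinuous if for any $\epsilon>0$ there are $k\in\mathbb{N}$ and measurable sets $A_1,\dots,A_k$ with $\mu\left(\bigcup_{i=1}^kA_i\right)>1-\epsilon$ such that if $x,y\in A_i$ for some $1\le i\le k$ then $$\limsup_{n\to\infty}\frac1n\sum_{j=0}^{n-1}|f(T^jx)-f(T^jy)|<\epsilon.$$ *)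

theory Defs
  imports "HOL-Probability.Probability"
begin

(* An everywhere-defined integrable representative f may be unbounded, so along some pair of
   points the Cesaro means may be unbounded; hence the limsup is taken in the extended reals. *)
definition mean_deviation ::
    "('a \<Rightarrow> 'a) \<Rightarrow> ('a \<Rightarrow> complex) \<Rightarrow> 'a \<Rightarrow> 'a \<Rightarrow> ereal" where
  "mean_deviation T f x y =
     limsup (\<lambda>n. ereal (1 / real n * (\<Sum>i<n. cmod (f ((T ^^ i) x) - f ((T ^^ i) y)))))"

definition mu_d_mean_equicontinuous ::
    "'a::metric_space measure \<Rightarrow> ('a \<Rightarrow> 'a) \<Rightarrow> ('a \<Rightarrow> complex) \<Rightarrow> bool" where
  "mu_d_mean_equicontinuous \<mu> T f \<longleftrightarrow>
     (\<forall>\<tau>>0. \<exists>K. compact K \<and> measure \<mu> K > 1 - \<tau> \<and>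
        (\<forall>\<epsilon>>0. \<exists>\<delta>>0. \<forall>x\<in>K. \<forall>y\<in>K.
           dist x y < \<delta> \<longrightarrow> mean_deviation T f x y < ereal \<epsilon>))"

definition mu_mean_equicontinuous ::
    "'a measure \<Rightarrow> ('a \<Rightarrow> 'a) \<Rightarrow> ('a \<Rightarrow> complex) \<Rightarrow> bool" where
  "mu_mean_equicontinuous \<mu> T f \<longleftrightarrow>
     (\<forall>\<epsilon>>0. \<exists>(k::nat) (A :: nat \<Rightarrow> 'a set).
        (\<forall>i\<in>{1..k}. A i \<in> sets \<mu>) \<and>
        measure \<mu> (\<Union>i\<in>{1..k}. A i) > 1 - \<epsilon> \<and>
        (\<forall>i\<in>{1..k}. \<forall>x\<in>A i. \<forall>y\<in>A i. mean_deviation T f x y < ereal \<epsilon>))"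

end

(* For the direction from (2) to (1), the sets A_1, ..., A_k belonging to
   an error bound can be made disjoint and then shrunk, by regularity of Borel measures on
   metric spaces, to disjoint compact sets at the cost of little mass. Disjoint compact sets have
   positive distance, so two points of their union that are close lie in the same A_i.
   Intersecting these unions over a summable sequence of error bounds yields K. *)
theory Submission
  imports Defs
begin

section \<open>Regularity of finite Borel measures on metric spaces\<close>

text \<open>The open neighbourhoods of \<open>S\<close> of radius \<open>1 / (n + 1)\<close> shrink
  to \<open>S\<close> because \<open>S\<close> is closed, so continuity from above sends the measure
  of their excess over \<open>S\<close> to 0.\<close>

lemma closed_outer_open_approx:
  fixes S :: "'a::metric_space set"
  assumes "finite_measure M" and M: "sets M = sets borel" and S: "closed S" and e: "e > 0"
  obtains U where "open U" "S \<subseteq> U" "measure M (U - S) < e"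
\<comment> \<open>By convention \<open>infdist x {}\<close> is 0, so for empty \<open>S\<close> the
  neighbourhoods below would be the whole space.\<close>
proof (cases "S = {}")
  case True
  then show ?thesis using that[of "{}"] e by simp
next
  case False
  interpret finite_measure M by fact
  define U where "U n = {x. infdist x S < inverse (real (Suc n))}" for n
  have opn: "open (U n)" for n
    unfolding U_def by (intro open_Collect_less continuous_intros)
  have sub: "S \<subseteq> U n" for n
    by (auto simp: U_def)
  have dec: "decseq (\<lambda>n. U n - S)"
    unfolding decseq_def U_def by (auto elim!: less_le_trans)
  have "(\<Inter>n. U n - S) = {}"
  proof (rule ccontr)
    assume "(\<Inter>n. U n - S) \<noteq> {}"
    then obtain x where x: "\<And>n. x \<in> U n" "x \<notin> S"
      by blast
    then have "infdist x S > 0"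
      using S False infdist_pos_not_in_closed by blast
    then obtain n where "inverse (real (Suc n)) < infdist x S"
      using reals_Archimedean by blast
    then show False
      using x(1)[of n] by (simp add: U_def)
  qed
  moreover have "(\<lambda>n. measure M (U n - S)) \<longlonglongrightarrow> measure M (\<Inter>n. U n - S)"
    by (rule finite_Lim_measure_decseq) (use opn S dec in \<open>auto simp: M\<close>)
  ultimately have "(\<lambda>n. measure M (U n - S)) \<longlonglongrightarrow> 0"
    by (simp only: measure_empty)
  then have "\<forall>\<^sub>F n in sequentially. measure M (U n - S) < e"
    using e by (rule order_tendstoD)
  then obtain n where "measure M (U n - S) < e"
    using eventually_happens by force
  then show ?thesis
    using that opn sub by blast
qed

(* HOL-Analysis.Regularity assumes a Polish space as a type class, which a metric space that is
   merely assumed compact does not instantiate. *)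
lemma closed_open_approx:
  fixes B :: "'a::metric_space set"
  assumes "finite_measure M" and M: "sets M = sets borel" and "B \<in> sets borel" and "e > 0"
  shows "\<exists>C U. closed C \<and> open U \<and> C \<subseteq> B \<and> B \<subseteq> U \<and> measure M (U - C) < e"
proof -
  interpret finite_measure M by fact
  have "B \<in> sigma_sets UNIV (Collect closed)"
    using \<open>B \<in> sets borel\<close> unfolding borel_eq_closed by (simp add: sets_measure_of)
  then show ?thesis
    using \<open>e > 0\<close>
  \<comment> \<open>Approximating from both sides at once is what makes the property stable under
    complements. The tolerance \<open>e\<close> stays arbitrary since the union case needs a smaller
    one for each set.\<close>
  proof (induction arbitrary: e rule: sigma_sets.induct)
    case (Basic S)
    then have "closed S"
      by simp
    then obtain U where "open U" "S \<subseteq> U" "measure M (U - S) < e"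
      using closed_outer_open_approx[OF assms(1) M _ Basic.prems] by metis
    then show ?case
      using \<open>closed S\<close> by blast
  next
    case Empty
    then show ?case
      by (intro exI[of _ "{}"]) auto
  next
    case (Compl S)
    obtain C U where "closed C" "open U" "C \<subseteq> S" "S \<subseteq> U" "measure M (U - C) < e"
      using Compl.IH[OF Compl.prems] by blast
    moreover have "- C - - U = U - C"
      by blast
    ultimately show ?case
      by (intro exI[of _ "- U"] exI[of _ "- C"]) auto
  next
    case (Union S)
    \<comment> \<open>The tolerances add up to \<open>e / 2\<close>, so the non-strict bound on the
      infinite sum still lies strictly below \<open>e\<close>.\<close>
    have "\<exists>C U. closed C \<and> open U \<and> C \<subseteq> S i \<and> S i \<subseteq> U \<and>
        measure M (U - C) < e / 2 * (1 / 2) ^ Suc i" for i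
      by (rule Union.IH) (use Union.prems in simp)
    then obtain C U where
      cl: "\<And>i. closed (C i)" and op: "\<And>i. open (U i)" and
      CS: "\<And>i. C i \<subseteq> S i" and SU: "\<And>i. S i \<subseteq> U i" and
      small: "\<And>i. measure M (U i - C i) < e / 2 * (1 / 2) ^ Suc i"
      by metis
    have bor [simp]: "C i \<in> sets borel" "U i \<in> sets borel" for i
      using cl op by auto
    have sums: "(\<lambda>i. e / 2 * (1 / 2) ^ Suc i) sums (e / 2)"
      using sums_mult[OF power_half_series, of "e / 2"] by simp
    have sm: "summable (\<lambda>i. measure M (U i - C i))"
      by (rule summable_comparison_test[OF _ sums_summable[OF sums]])
        (use small in \<open>auto intro!: less_imp_le exI[of _ 0]\<close>)
    have "measure M ((\<Union>i. U i) - (\<Union>i. C i)) \<le> measure M (\<Union>i. U i - C i)"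
      by (rule finite_measure_mono) (auto simp: M intro!: sets.countable_UN sets.Diff)
    also have "\<dots> \<le> (\<Sum>i. measure M (U i - C i))"
      using sm by (intro finite_measure_subadditive_countably) (auto simp: M)
    also have "\<dots> \<le> e / 2"
      by (rule sums_le[OF less_imp_le[OF small] summable_sums[OF sm] sums])
    also have "\<dots> < e"
      using Union.prems by simp
    finally have lt: "measure M ((\<Union>i. U i) - (\<Union>i. C i)) < e" .
    \<comment> \<open>A countable union of closed sets need not be closed. Continuity from above
      allows it to be cut down to a finite union.\<close>
    have "(\<lambda>n. measure M ((\<Union>i. U i) - (\<Union>i<n. C i)))
        \<longlonglongrightarrow> measure M (\<Inter>n. (\<Union>i. U i) - (\<Union>i<n. C i))"
      by (rule finite_Lim_measure_decseq)
        (auto simp: M decseq_def intro!: sets.countable_UN sets.Diff)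
    also have "(\<Inter>n. (\<Union>i. U i) - (\<Union>i<n. C i)) = (\<Union>i. U i) - (\<Union>i. C i)"
      by auto
    finally have "\<forall>\<^sub>F n in sequentially. measure M ((\<Union>i. U i) - (\<Union>i<n. C i)) < e"
      using lt by (rule order_tendstoD)
    then obtain n where "measure M ((\<Union>i. U i) - (\<Union>i<n. C i)) < e"
      using eventually_happens by force
    moreover have "closed (\<Union>i<n. C i)" "open (\<Union>i. U i)"
      using cl op by auto
    moreover have "(\<Union>i<n. C i) \<subseteq> (\<Union>i. S i)" "(\<Union>i. S i) \<subseteq> (\<Union>i. U i)"
      using CS SU by blast+
    ultimately show ?case
      by blast
  qed
qed

section \<open>Disjoint closed pieces and their separation\<close>

text \<open>Subtracting from each set its predecessors gives disjoint pieces \<open>B i\<close> with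
  the same union. Each is replaced by a closed subset, and the allowed loss \<open>e\<close> is
  shared among the \<open>k\<close> pieces.\<close>

lemma disjoint_closed_shrinking:
  fixes A :: "nat \<Rightarrow> 'a::metric_space set"
  assumes "finite_measure M" and M: "sets M = sets borel"
    and A: "A ` {1..k} \<subseteq> sets borel" and e: "e > 0"
  shows "\<exists>C. (\<forall>i\<in>{1..k}. closed (C i) \<and> C i \<subseteq> A i) \<and> disjoint_family_on C {1..k} \<and>
    measure M (\<Union>i\<in>{1..k}. A i) < measure M (\<Union>i\<in>{1..k}. C i) + e"
proof -
  interpret finite_measure M by fact
  define B where "B i = A i - (\<Union>j\<in>{1..<i}. A j)" for i
  have B: "B i \<in> sets borel" if "i \<in> {1..k}" for i
    unfolding B_def using A that by (auto intro!: sets.Diff sets.finite_UN)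
  have UB: "(\<Union>i\<in>{1..k}. A i) \<subseteq> (\<Union>i\<in>{1..k}. B i)"
  proof
    fix x assume "x \<in> (\<Union>i\<in>{1..k}. A i)"
    then obtain i where i: "i \<in> {1..k} \<and> x \<in> A i"
      by blast
    \<comment> \<open>The piece that contains \<open>x\<close> is the one belonging to the first
      \<open>A i\<close> that contains \<open>x\<close>.\<close>
    define l where "l = (LEAST i. i \<in> {1..k} \<and> x \<in> A i)"
    have "l \<in> {1..k} \<and> x \<in> A l"
      unfolding l_def using i by (rule LeastI)
    moreover have "x \<notin> A j" if "j \<in> {1..<l}" for j
      using not_less_Least[of j "\<lambda>i. i \<in> {1..k} \<and> x \<in> A i"] that calculation
      unfolding l_def[symmetric] by auto
    ultimately show "x \<in> (\<Union>i\<in>{1..k}. B i)"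
      by (auto simp: B_def)
  qed
  \<comment> \<open>The summand 1 keeps \<open>d\<close> positive when \<open>k\<close> is
    0.\<close>
  define d where "d = e / (2 * (real k + 1))"
  have d: "d > 0" "real k * d < e"
    using e by (auto simp: d_def field_simps add_nonneg_pos)
  have "\<exists>C. closed C \<and> C \<subseteq> B i \<and> measure M (B i - C) < d" if i: "i \<in> {1..k}" for i
  proof -
    obtain C U where "closed C" "open U" "C \<subseteq> B i" "B i \<subseteq> U" "measure M (U - C) < d"
      using closed_open_approx[OF assms(1) M B[OF i] d(1)] by blast
    moreover have "measure M (B i - C) \<le> measure M (U - C)"
      by (rule finite_measure_mono) (use calculation in \<open>auto simp: M\<close>)
    ultimately show ?thesis
      by force
  qed
  then obtain C where C: "\<And>i. i \<in> {1..k} \<Longrightarrow> closed (C i)" "\<And>i. i \<in> {1..k} \<Longrightarrow> C i \<subseteq> B i"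
    "\<And>i. i \<in> {1..k} \<Longrightarrow> measure M (B i - C i) < d"
    by metis
  have [simp]: "C i \<in> sets M" "B i \<in> sets M" if "i \<in> {1..k}" for i
    using C(1) B that by (auto simp: M)
  have "measure M (\<Union>i\<in>{1..k}. A i) \<le> measure M ((\<Union>i\<in>{1..k}. C i) \<union> (\<Union>i\<in>{1..k}. B i - C i))"
    using UB by (intro finite_measure_mono sets.Un sets.finite_UN sets.Diff) auto
  also have "\<dots> \<le> measure M (\<Union>i\<in>{1..k}. C i) + measure M (\<Union>i\<in>{1..k}. B i - C i)"
    by (intro measure_Un_le sets.finite_UN sets.Diff) auto
  also have "measure M (\<Union>i\<in>{1..k}. B i - C i) \<le> (\<Sum>i\<in>{1..k}. measure M (B i - C i))"
    by (intro finite_measure_subadditive_finite) auto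
  also have "\<dots> \<le> real k * d"
    using sum_bounded_above[of "{1..k}" "\<lambda>i. measure M (B i - C i)" d] C(3)
    by (auto intro: less_imp_le)
  finally have "measure M (\<Union>i\<in>{1..k}. A i) < measure M (\<Union>i\<in>{1..k}. C i) + e"
    using d(2) by linarith
  moreover have "disjoint_family_on B {1..k}"
    unfolding disjoint_family_on_def
  proof (intro ballI impI)
    fix i j assume "i \<in> {1..k}" "j \<in> {1..k}" "i \<noteq> j"
    then show "B i \<inter> B j = {}"
      by (cases i j rule: linorder_cases) (auto simp: B_def)
  qed
  then have "disjoint_family_on C {1..k}"
    using C(2) unfolding disjoint_family_on_def by blast
  moreover have "C i \<subseteq> A i" if "i \<in> {1..k}" for i
    using C(2)[OF that] by (auto simp: B_def)
  ultimately show ?thesis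
    using C(1) by blast
qed

text \<open>The number \<open>d\<close> is a Lebesgue number of an open cover of the compact union,
  which avoids computing pairwise distances.\<close>

lemma disjoint_compact_family_separated:
  fixes C :: "'i \<Rightarrow> 'a::metric_space set"
  assumes "finite I" and C: "\<And>i. i \<in> I \<Longrightarrow> compact (C i)" and disj: "disjoint_family_on C I"
  obtains d where "d > 0"
    "\<And>x y. x \<in> (\<Union>i\<in>I. C i) \<Longrightarrow> y \<in> (\<Union>i\<in>I. C i) \<Longrightarrow> dist x y < d \<Longrightarrow> \<exists>i\<in>I. x \<in> C i \<and> y \<in> C i"
proof -
  \<comment> \<open>By disjointness \<open>C i\<close> lies in \<open>G i\<close>, and a point of
    the union that lies in \<open>G i\<close> can only come from \<open>C i\<close>.\<close>
  define G where "G i = - (\<Union>j\<in>I - {i}. C j)" for i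
  have "compact (\<Union>i\<in>I. C i)"
    using assms by (intro compact_UN) auto
  moreover have "(\<Union>i\<in>I. C i) \<subseteq> \<Union>(G ` I)"
    using disj by (auto simp: G_def disjoint_family_on_def)
  moreover have "open V" if "V \<in> G ` I" for V
    using that assms by (auto simp: G_def intro!: open_Compl closed_UN compact_imp_closed)
  ultimately obtain d where d: "d > 0" "\<And>x. x \<in> (\<Union>i\<in>I. C i) \<Longrightarrow> \<exists>V\<in>G ` I. ball x d \<subseteq> V"
    using Heine_Borel_lemma[of "\<Union>i\<in>I. C i" "G ` I"] by metis
  show ?thesis
  proof
    show "d > 0" by fact
    fix x y assume x: "x \<in> (\<Union>i\<in>I. C i)" and y: "y \<in> (\<Union>i\<in>I. C i)" and "dist x y < d"
    obtain i where "i \<in> I" "ball x d \<subseteq> G i"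
      using d(2)[OF x] by blast
    then have "x \<in> G i" "y \<in> G i"
      using \<open>d > 0\<close> \<open>dist x y < d\<close> by auto
    then show "\<exists>i\<in>I. x \<in> C i \<and> y \<in> C i"
      using \<open>i \<in> I\<close> x y by (auto simp: G_def)
  qed
qed

section \<open>The implication from (1) to (2)\<close>

text \<open>A compact set is totally bounded, so finitely many balls of radius
  \<open>\<delta> / 2\<close> cut \<open>K\<close> into pieces in which any two points are less than
  \<open>\<delta>\<close> apart.\<close>

lemma mu_d_mean_equicontinuous_imp_mu_mean_equicontinuous:
  fixes T :: "'a::metric_space \<Rightarrow> 'a"
  assumes M: "sets \<mu> = sets borel" and equi: "mu_d_mean_equicontinuous \<mu> T f"
  shows "mu_mean_equicontinuous \<mu> T f"
  unfolding mu_mean_equicontinuous_def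
proof (intro allI impI)
  fix \<epsilon> :: real assume "\<epsilon> > 0"
  then obtain K \<delta> where K: "compact K" "measure \<mu> K > 1 - \<epsilon>" and "\<delta> > 0"
    and \<delta>: "\<And>x y. x \<in> K \<Longrightarrow> y \<in> K \<Longrightarrow> dist x y < \<delta> \<Longrightarrow> mean_deviation T f x y < ereal \<epsilon>"
    using equi unfolding mu_d_mean_equicontinuous_def by meson
  have "seq_compact K"
    using K(1) by (simp add: compact_eq_seq_compact_metric)
  then obtain D where "finite D" and D: "K \<subseteq> (\<Union>c\<in>D. ball c (\<delta> / 2))"
    using seq_compact_imp_totally_bounded \<open>\<delta> > 0\<close> half_gt_zero by metis
  obtain c where c: "bij_betw c {1..card D} D"
    using ex_bij_betw_nat_finite_1[OF \<open>finite D\<close>] by blast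
  define A where "A i = K \<inter> ball (c i) (\<delta> / 2)" for i
  have "(\<Union>i\<in>{1..card D}. A i) = K \<inter> (\<Union>z\<in>c ` {1..card D}. ball z (\<delta> / 2))"
    by (auto simp: A_def)
  also have "\<dots> = K"
    using D c by (auto simp: bij_betw_imp_surj_on)
  finally have "(\<Union>i\<in>{1..card D}. A i) = K" .
  moreover have "A i \<in> sets \<mu>" for i
    using K(1) by (auto simp: A_def M compact_imp_closed)
  moreover have "mean_deviation T f x y < ereal \<epsilon>" if "x \<in> A i" "y \<in> A i" for x y i
    using that dist_triangle_half_r[of "c i" x \<delta> y] by (intro \<delta>) (auto simp: A_def)
  ultimately show "\<exists>(k::nat) A. (\<forall>i\<in>{1..k}. A i \<in> sets \<mu>) \<and> 1 - \<epsilon> < measure \<mu> (\<Union>i\<in>{1..k}. A i) \<and>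
      (\<forall>i\<in>{1..k}. \<forall>x\<in>A i. \<forall>y\<in>A i. mean_deviation T f x y < ereal \<epsilon>)"
    using K(2) by (intro exI[of _ "card D"] exI[of _ A]) auto
qed

section \<open>The implication from (2) to (1)\<close>

text \<open>This treats a single error bound: the same \<open>\<epsilon>\<close> controls both the
  lost mass and the deviation. Closed pieces are compact because the whole space is.\<close>

lemma mu_mean_equicontinuous_compact_set:
  fixes T :: "'a::metric_space \<Rightarrow> 'a"
  assumes "compact (UNIV :: 'a set)" and "finite_measure \<mu>" and M: "sets \<mu> = sets borel"
    and equi: "mu_mean_equicontinuous \<mu> T f" and "\<epsilon> > 0"
  shows "\<exists>K. compact K \<and> measure \<mu> K > 1 - \<epsilon> \<and> (\<exists>\<delta>>0. \<forall>x\<in>K. \<forall>y\<in>K.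
    dist x y < \<delta> \<longrightarrow> mean_deviation T f x y < ereal \<epsilon>)"
proof -
  obtain k :: nat and A where A: "A ` {1..k} \<subseteq> sets borel"
    and big: "measure \<mu> (\<Union>i\<in>{1..k}. A i) > 1 - \<epsilon>"
    and dev: "\<And>i x y. i \<in> {1..k} \<Longrightarrow> x \<in> A i \<Longrightarrow> y \<in> A i \<Longrightarrow> mean_deviation T f x y < ereal \<epsilon>"
    using equi \<open>\<epsilon> > 0\<close> unfolding mu_mean_equicontinuous_def M image_subset_iff by meson
  \<comment> \<open>The margin above \<open>1 - \<epsilon>\<close> serves as the loss allowed in the
    shrinking, so the closed pieces still have mass above \<open>1 - \<epsilon>\<close>.\<close>
  have pos: "measure \<mu> (\<Union>i\<in>{1..k}. A i) - (1 - \<epsilon>) > 0"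
    using big by simp
  obtain C where C: "\<forall>i\<in>{1..k}. closed (C i) \<and> C i \<subseteq> A i"
    and disj: "disjoint_family_on C {1..k}"
    and lt: "measure \<mu> (\<Union>i\<in>{1..k}. A i) < measure \<mu> (\<Union>i\<in>{1..k}. C i)
      + (measure \<mu> (\<Union>i\<in>{1..k}. A i) - (1 - \<epsilon>))"
    using disjoint_closed_shrinking[OF assms(2) M A pos] by (elim exE conjE)
  have cl: "closed (C i)" and CA: "C i \<subseteq> A i" if "i \<in> {1..k}" for i
    using C that by blast+
  have cpt: "compact (C i)" if "i \<in> {1..k}" for i
    using compact_Int_closed[OF assms(1) cl[OF that]] by simp
  obtain d where "d > 0" and d: "\<And>x y. x \<in> (\<Union>i\<in>{1..k}. C i) \<Longrightarrow> y \<in> (\<Union>i\<in>{1..k}. C i) \<Longrightarrow>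
      dist x y < d \<Longrightarrow> \<exists>i\<in>{1..k}. x \<in> C i \<and> y \<in> C i"
    by (rule disjoint_compact_family_separated[OF _ cpt disj]) auto
  have "mean_deviation T f x y < ereal \<epsilon>"
    if "x \<in> (\<Union>i\<in>{1..k}. C i)" "y \<in> (\<Union>i\<in>{1..k}. C i)" "dist x y < d" for x y
    using d[OF that] CA dev by blast
  moreover have "compact (\<Union>i\<in>{1..k}. C i)"
    using cpt by (intro compact_UN) auto
  moreover have "measure \<mu> (\<Union>i\<in>{1..k}. C i) > 1 - \<epsilon>"
    using lt by simp
  ultimately show ?thesis
    using \<open>d > 0\<close> by blast
qed

lemma mu_mean_equicontinuous_imp_mu_d_mean_equicontinuous:
  fixes T :: "'a::metric_space \<Rightarrow> 'a"
  assumes cpt: "compact (UNIV :: 'a set)" and "prob_space \<mu>" and M: "sets \<mu> = sets borel"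
    and equi: "mu_mean_equicontinuous \<mu> T f"
  shows "mu_d_mean_equicontinuous \<mu> T f"
  unfolding mu_d_mean_equicontinuous_def
proof (intro allI impI)
  interpret prob_space \<mu> by fact
  have sp: "space \<mu> = UNIV"
    using sets_eq_imp_space_eq[OF M] by simp
  fix \<tau> :: real assume "\<tau> > 0"
  \<comment> \<open>These bounds sum to \<open>\<tau> / 2\<close>, which limits the mass lost by the
    intersection, and they tend to 0, so that every \<open>\<epsilon>\<close> eventually exceeds
    them.\<close>
  define e where "e n = \<tau> / 2 * (1 / 2) ^ Suc n" for n
  have sums: "e sums (\<tau> / 2)"
    using sums_mult[OF power_half_series, of "\<tau> / 2"] unfolding e_def by simp
  have "e n > 0" for n
    using \<open>\<tau> > 0\<close> by (simp add: e_def)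
  then have "\<exists>K. compact K \<and> measure \<mu> K > 1 - e n \<and> (\<exists>\<delta>>0. \<forall>x\<in>K. \<forall>y\<in>K.
      dist x y < \<delta> \<longrightarrow> mean_deviation T f x y < ereal (e n))" for n
    by (intro mu_mean_equicontinuous_compact_set[OF cpt finite_measure_axioms M equi])
  then obtain K where K: "\<And>n. compact (K n)" "\<And>n. measure \<mu> (K n) > 1 - e n"
    and dev: "\<And>n. \<exists>\<delta>>0. \<forall>x\<in>K n. \<forall>y\<in>K n. dist x y < \<delta> \<longrightarrow> mean_deviation T f x y < ereal (e n)"
    by metis
  have cptK: "compact (\<Inter>n. K n)"
    using K(1) compact_Int_closed[OF cpt closed_INT, of UNIV K] by (simp add: compact_imp_closed)
  have [simp]: "K n \<in> sets \<mu>" "- K n \<in> sets \<mu>" for n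
    using K(1)[of n] by (auto simp: M compact_imp_closed)
  have le: "measure \<mu> (- K n) \<le> e n" for n
    using prob_compl[of "K n"] K(2)[of n] by (simp add: sp Compl_eq_Diff_UNIV)
  have sm: "summable (\<lambda>n. measure \<mu> (- K n))"
    by (rule summable_comparison_test[OF _ sums_summable[OF sums]]) (use le in auto)
  have "measure \<mu> (\<Union>n. - K n) \<le> (\<Sum>n. measure \<mu> (- K n))"
    using sm by (intro finite_measure_subadditive_countably) auto
  also have "\<dots> \<le> (\<Sum>n. e n)"
    using le sm sums_summable[OF sums] by (rule suminf_le)
  also have "\<dots> < \<tau>"
    using sums_unique[OF sums] \<open>\<tau> > 0\<close> by simp
  finally have "measure \<mu> (\<Union>n. - K n) < \<tau>" .
  moreover have "measure \<mu> (UNIV - (\<Inter>n. K n)) = 1 - measure \<mu> (\<Inter>n. K n)"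
    using prob_compl[of "\<Inter>n. K n"] compact_imp_closed[OF cptK] by (simp add: sp M borel_closed)
  moreover have "(\<Union>n. - K n) = UNIV - (\<Inter>n. K n)"
    by blast
  ultimately have "measure \<mu> (\<Inter>n. K n) > 1 - \<tau>"
    by simp
  moreover note cptK
  \<comment> \<open>The intersection is fixed before \<open>\<epsilon>\<close> is given. It lies in
    every \<open>K n\<close>, so it inherits the \<open>\<delta>\<close> of any \<open>K n\<close>
    with \<open>e n < \<epsilon>\<close>.\<close>
  moreover have "\<exists>\<delta>>0. \<forall>x\<in>\<Inter>n. K n. \<forall>y\<in>\<Inter>n. K n.
      dist x y < \<delta> \<longrightarrow> mean_deviation T f x y < ereal \<epsilon>" if "\<epsilon> > 0" for \<epsilon>
  proof -
    have "\<forall>\<^sub>F n in sequentially. e n < \<epsilon>"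
      using summable_LIMSEQ_zero[OF sums_summable[OF sums]] that by (rule order_tendstoD)
    then obtain n where "e n < \<epsilon>"
      using eventually_happens by force
    then have "mean_deviation T f x y < ereal \<epsilon>" if "mean_deviation T f x y < ereal (e n)" for x y
      using that less_trans by fastforce
    then show ?thesis
      using dev[of n] by (meson INT_E UNIV_I)
  qed
  ultimately show "\<exists>K. compact K \<and> 1 - \<tau> < measure \<mu> K \<and> (\<forall>\<epsilon>>0. \<exists>\<delta>>0. \<forall>x\<in>K. \<forall>y\<in>K.
      dist x y < \<delta> \<longrightarrow> mean_deviation T f x y < ereal \<epsilon>)"
    by blast
qed

theorem proposition4p3:
  fixes T :: "'a::metric_space \<Rightarrow> 'a"
    and \<mu> :: "'a measure"
    and f :: "'a \<Rightarrow> complex"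
  assumes "compact (UNIV :: 'a set)"
    and "homeomorphic_map euclidean euclidean T"
    and "prob_space \<mu>"
    and "sets \<mu> = sets borel"
    and "distr \<mu> \<mu> T = \<mu>"
    and "integrable \<mu> f"
  shows "mu_d_mean_equicontinuous \<mu> T f \<longleftrightarrow> mu_mean_equicontinuous \<mu> T f"
  using mu_d_mean_equicontinuous_imp_mu_mean_equicontinuous[OF assms(4)]
    mu_mean_equicontinuous_imp_mu_d_mean_equicontinuous[OF assms(1,3,4)]
  by blast

end
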